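(* Let $p$ be an odd prime, let $d\in\{0,1,\ldots,(p-1)/2\}$, and let $\lambda$ be a rational $p$-adic integer. Define $$a_p^{(d)}(\lambda):=\sum_{x=0}^{p-1}x^d\left(\frac{x(x-1)(x-\lambda)}p\right).$$ Then $$a_p^{(d)}(\lambda)\equiv (-1)^{(p+1)/2}\frac{\lambda^d}{4^d}\sum_{k=0}^{(p-1)/2}\frac{\binom{2k}k\binom{2(k+d)}{k+d}}{16^k}\lambda^k-\delta_{d,(p-1)/2}\pmod{p}.$$
   Context: $\left(\frac{\cdot}{p}\right)$ denotes the Legendre symbol (extended to rational $p$-adic integers via their residue mod $p$; it is $0$ on multiples of $p$). A rational $p$-adic integer is a rational number whose denominator is not divisible by $p$; for such numbers $a,b$, $a\equiv b\pmod{p^m}$ means $(a-b)/p^m$ is a rational $p$-adic integer. $\delta_{i,j}$ is the Kronecker delta, and $x^0=1$ for all $x$ (including $x=0$). *)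

theory Defs
  imports "HOL-Number_Theory.Number_Theory"
begin

definition padic_integer :: "nat \<Rightarrow> rat \<Rightarrow> bool" where
  "padic_integer p x \<longleftrightarrow> \<not> int p dvd snd (quotient_of x)"

definition padic_cong :: "nat \<Rightarrow> nat \<Rightarrow> rat \<Rightarrow> rat \<Rightarrow> bool" where
  "padic_cong p m a b \<longleftrightarrow> padic_integer p ((a - b) / of_nat p ^ m)"

text \<open>Only meaningful for prime \<open>p\<close> and rational \<open>p\<close>-adic integers, where the description
  is satisfied by exactly one \<open>r\<close>; see \<open>padic_residue_unique\<close>.\<close>

definition padic_residue :: "nat \<Rightarrow> rat \<Rightarrow> int" where
  "padic_residue p x = (THE r. 0 \<le> r \<and> r < int p \<and> padic_cong p 1 x (of_int r))"

definition padic_Legendre :: "rat \<Rightarrow> nat \<Rightarrow> int" where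
  "padic_Legendre x p = Legendre (padic_residue p x) (int p)"

definition a_sum :: "nat \<Rightarrow> nat \<Rightarrow> rat \<Rightarrow> int" where
  "a_sum p d l =
     (\<Sum>x = 0..p - 1. int x ^ d * padic_Legendre (of_nat x * (of_nat x - 1) * (of_nat x - l)) p)"

lemma padic_integer_Fract_iff:
  assumes p: "prime p"
  shows "padic_integer p x \<longleftrightarrow> (\<exists>a b. \<not> int p dvd b \<and> x = Fract a b)"
proof
  assume "padic_integer p x"
  moreover have "x = Fract (fst (quotient_of x)) (snd (quotient_of x))"
    by (metis Fract_of_int_quotient prod.collapse quotient_of_div)
  ultimately show "\<exists>a b. \<not> int p dvd b \<and> x = Fract a b"
    unfolding padic_integer_def by blast
next
  assume "\<exists>a b. \<not> int p dvd b \<and> x = Fract a b"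
  then obtain a b where ab: "\<not> int p dvd b" "x = Fract a b" by blast
  obtain c e where q: "quotient_of x = (c, e)" by fastforce
  have e: "e > 0" "coprime c e" "x = Fract c e"
    using quotient_of_denom_pos[OF q] quotient_of_coprime[OF q] quotient_of_div[OF q]
    by (simp_all add: Fract_of_int_quotient)
  have "b \<noteq> 0" using ab(1) by auto
  then have "a * e = c * b" using e ab(2) by (simp add: eq_rat)
  then have "e dvd c * b" by (metis dvd_triv_right)
  then have "e dvd b" using e(2) by (metis coprime_commute coprime_dvd_mult_right_iff)
  then show "padic_integer p x"
    using ab(1) q dvd_trans unfolding padic_integer_def by auto
qed

lemma padic_residue_unique:
  assumes p: "prime p" and x: "padic_integer p x"
  shows "\<exists>!r. 0 \<le> r \<and> r < int p \<and> padic_cong p 1 x (of_int r)"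
proof -
  have p': "prime (int p)" "int p > 0" using p by (simp_all add: prime_gt_0_nat)
  obtain a b where ab: "\<not> int p dvd b" "x = Fract a b"
    using x padic_integer_Fract_iff[OF p] by blast
  have b0: "b \<noteq> 0" using ab(1) by auto
  have key: "padic_cong p 1 x (of_int r) \<longleftrightarrow> [a = r * b] (mod int p)" for r
  proof
    assume "padic_cong p 1 x (of_int r)"
    then obtain c e where ce: "\<not> int p dvd e" "(x - of_int r) / of_nat p = Fract c e"
      using padic_integer_Fract_iff[OF p] unfolding padic_cong_def by auto
    have "e \<noteq> 0" using ce(1) by auto
    then have "(of_int ((a - r * b) * e) :: rat) = of_int (int p * c * b)"
      using ce(2) b0 p' unfolding ab(2) by (simp add: Fract_of_int_quotient field_simps)
    then have "(a - r * b) * e = int p * c * b" by (simp only: of_int_eq_iff)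
    then have "int p dvd (a - r * b) * e" by simp
    then show "[a = r * b] (mod int p)"
      using p'(1) ce(1) by (simp add: prime_dvd_mult_iff cong_iff_dvd_diff)
  next
    assume "[a = r * b] (mod int p)"
    then obtain c where c: "a - r * b = int p * c" by (auto simp: cong_iff_dvd_diff)
    then have "(of_int (a - r * b) :: rat) = of_int (int p * c)" by (simp only:)
    then have "(x - of_int r) / of_nat p = Fract c b"
      using b0 p' unfolding ab(2) by (simp add: Fract_of_int_quotient field_simps)
    then show "padic_cong p 1 x (of_int r)"
      using ab(1) padic_integer_Fract_iff[OF p] unfolding padic_cong_def by auto
  qed
  have cop: "coprime b (int p)"
    using ab(1) p'(1) by (metis coprime_commute prime_imp_coprime)
  then obtain i where i: "[b * i = 1] (mod int p)" by (metis cong_solve_coprime_int)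
  show ?thesis
  proof (rule ex1I[of _ "(a * i) mod int p"])
    have "[(a * i) mod int p * b = a * (b * i)] (mod int p)"
      by (simp add: cong_def mod_simps mult.assoc mult.commute[of b i])
    also have "[a * (b * i) = a * 1] (mod int p)" by (rule cong_scalar_left[OF i])
    finally have c: "[a = (a * i) mod int p * b] (mod int p)" by (simp add: cong_sym_eq)
    show "0 \<le> (a * i) mod int p \<and> (a * i) mod int p < int p
        \<and> padic_cong p 1 x (of_int ((a * i) mod int p))"
      using p'(2) c unfolding key by simp
    fix r assume r: "0 \<le> r \<and> r < int p \<and> padic_cong p 1 x (of_int r)"
    have "[r * b = (a * i) mod int p * b] (mod int p)"
      using r c by (metis key cong_sym cong_trans)
    then have "[r = (a * i) mod int p] (mod int p)"
      using cop by (simp add: cong_mult_rcancel)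
    then show "r = (a * i) mod int p" using r by (simp add: cong_def)
  qed
qed

end

theory Submission
  imports Defs
begin

text \<open>
  Put \<open>n = (p - 1) / 2\<close> and let \<open>r\<close> be an integer congruent to \<open>\<lambda>\<close>. By Euler's criterion the
  sum is congruent to the sum of the values of the polynomial \<open>x\<^bsup>n+d\<^esup> (x - 1)\<^sup>n (x - r)\<^sup>n\<close> at
  \<open>0, \<dots>, p - 1\<close>. The power sum of exponent \<open>j > 0\<close> is \<open>-1\<close> modulo \<open>p\<close> if \<open>p - 1\<close> divides \<open>j\<close> and
  \<open>0\<close> otherwise, and the polynomial has degree \<open>3n + d \<le> 2(p - 1)\<close>, so only the coefficients of
  \<open>x\<^bsup>2n\<^esup>\<close> and, when \<open>d = n\<close>, of \<open>x\<^bsup>4n\<^esup>\<close> survive. The latter yields the Kronecker delta, and the former is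
  \<open>(-1)\<^bsup>n+d\<^esup> \<Sum>\<^sub>i binom(n, i) binom(n, i + d) r\<^bsup>i+d\<^esup>\<close>. As \<open>n\<close> is \<open>-1/2\<close> modulo \<open>p\<close>, the
  coefficient \<open>binom(n, k)\<close> is congruent to \<open>binom(2k, k) / (-4)\<^sup>k\<close> for \<open>k < p\<close>.
\<close>

section \<open>Rational \<open>p\<close>-adic integers\<close>

lemma padic_integer_of_int [simp]:
  assumes "prime p"
  shows "padic_integer p (of_int a)"
proof -
  have "\<not> int p dvd 1"
    using assms by (metis not_prime_unit prime_nat_int_transfer)
  then show ?thesis
    unfolding padic_integer_def by simp
qed

lemma padic_integer_divide:
  assumes "prime p" "\<not> int p dvd b"
  shows "padic_integer p (of_int a / of_int b)"
  using assms padic_integer_Fract_iff Fract_of_int_quotient by metis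

lemma padic_integerE:
  assumes "prime p" "padic_integer p x"
  obtains a b where "\<not> int p dvd b" "b \<noteq> 0" "x = of_int a / of_int b"
proof -
  obtain a b where ab: "\<not> int p dvd b" "x = Fract a b"
    using assms padic_integer_Fract_iff by blast
  moreover from ab(1) have "b \<noteq> 0"
    by auto
  ultimately show ?thesis
    using that by (simp add: Fract_of_int_quotient)
qed

lemma padic_integer_add:
  assumes p: "prime p" and "padic_integer p x" "padic_integer p y"
  shows "padic_integer p (x + y)"
proof -
  obtain a b where x: "\<not> int p dvd b" "b \<noteq> 0" "x = of_int a / of_int b"
    using padic_integerE assms by blast
  obtain c e where y: "\<not> int p dvd e" "e \<noteq> 0" "y = of_int c / of_int e"
    using padic_integerE assms by blast
  have "x + y = of_int (a * e + c * b) / of_int (b * e)"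
    using x y by (simp add: field_simps)
  moreover have "\<not> int p dvd b * e"
    using p x(1) y(1) by (simp add: prime_dvd_mult_iff)
  ultimately show ?thesis
    using padic_integer_divide[OF p] by metis
qed

lemma padic_integer_mult:
  assumes p: "prime p" and "padic_integer p x" "padic_integer p y"
  shows "padic_integer p (x * y)"
proof -
  obtain a b where x: "\<not> int p dvd b" "b \<noteq> 0" "x = of_int a / of_int b"
    using padic_integerE assms by blast
  obtain c e where y: "\<not> int p dvd e" "e \<noteq> 0" "y = of_int c / of_int e"
    using padic_integerE assms by blast
  have "x * y = of_int (a * c) / of_int (b * e)"
    using x y by (simp add: field_simps)
  moreover have "\<not> int p dvd b * e"
    using p x(1) y(1) by (simp add: prime_dvd_mult_iff)
  ultimately show ?thesis
    using padic_integer_divide[OF p] by metis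
qed

lemma padic_integer_minus:
  assumes "prime p" "padic_integer p x"
  shows "padic_integer p (- x)"
  using padic_integer_mult[OF assms(1) padic_integer_of_int[OF assms(1), of "-1"] assms(2)]
  by simp

lemma padic_integer_power:
  assumes "prime p" "padic_integer p x"
  shows "padic_integer p (x ^ k)"
  using assms padic_integer_of_int[of p 1] by (induction k) (auto intro: padic_integer_mult)

section \<open>Arithmetic of p-adic congruences\<close>

lemma padic_cong_refl [simp]:
  assumes "prime p"
  shows "padic_cong p m a a"
  unfolding padic_cong_def using padic_integer_of_int[OF assms, of 0] by simp

lemma padic_cong_sym:
  assumes "prime p" "padic_cong p m a b"
  shows "padic_cong p m b a"
  using padic_integer_minus[OF assms(1), of "(a - b) / of_nat p ^ m"] assms(2)
  unfolding padic_cong_def by (simp add: diff_divide_distrib)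

lemma padic_cong_trans:
  assumes "prime p" "padic_cong p m a b" "padic_cong p m b c"
  shows "padic_cong p m a c"
  using padic_integer_add[OF assms(1), of "(a - b) / of_nat p ^ m" "(b - c) / of_nat p ^ m"]
    assms(2,3)
  unfolding padic_cong_def by (simp add: diff_divide_distrib)

lemma padic_cong_add:
  assumes "prime p" "padic_cong p m a b" "padic_cong p m c e"
  shows "padic_cong p m (a + c) (b + e)"
  using padic_integer_add[OF assms(1), of "(a - b) / of_nat p ^ m" "(c - e) / of_nat p ^ m"]
    assms(2,3)
  unfolding padic_cong_def by (simp add: diff_divide_distrib add_divide_distrib algebra_simps)

lemma padic_cong_mult_left:
  assumes "prime p" "padic_cong p m a b" "padic_integer p c"
  shows "padic_cong p m (c * a) (c * b)"
  using padic_integer_mult[OF assms(1,3), of "(a - b) / of_nat p ^ m"] assms(2)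
  unfolding padic_cong_def by (simp add: algebra_simps)

text \<open>Since \<open>a * c - b * e = a * (c - e) + e * (a - b)\<close>, it is enough that
  \<open>a\<close> and \<open>e\<close> are p-integral.\<close>

lemma padic_cong_mult:
  assumes p: "prime p" and "padic_cong p m a b" "padic_cong p m c e"
    and "padic_integer p a" "padic_integer p e"
  shows "padic_cong p m (a * c) (b * e)"
proof (rule padic_cong_trans[OF p])
  show "padic_cong p m (a * c) (a * e)"
    using assms by (intro padic_cong_mult_left)
  show "padic_cong p m (a * e) (b * e)"
    using padic_cong_mult_left[OF p, of m a b e] assms by (simp add: mult.commute)
qed

lemma padic_cong_diff:
  assumes "prime p" "padic_cong p m a b" "padic_cong p m c e"
  shows "padic_cong p m (a - c) (b - e)"
  using padic_cong_add[OF assms(1,2), of "- c" "- e"]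
    padic_cong_mult_left[OF assms(1,3) padic_integer_of_int[OF assms(1), of "-1"]] by simp

lemma padic_cong_sum:
  assumes "prime p" "\<And>i. i \<in> A \<Longrightarrow> padic_cong p m (f i) (g i)"
  shows "padic_cong p m (sum f A) (sum g A)"
  using assms by (induction A rule: infinite_finite_induct) (auto intro: padic_cong_add)

lemma padic_cong_power:
  assumes "prime p" "padic_cong p m x (of_int r)" "padic_integer p x"
  shows "padic_cong p m (x ^ k) (of_int r ^ k)"
proof (induction k)
  case (Suc k)
  have "padic_integer p (of_int r ^ k)"
    using padic_integer_of_int[OF assms(1), of "r ^ k"] by simp
  then show ?case
    using Suc assms by (auto intro: padic_cong_mult)
qed (use assms in simp)

text \<open>The bridge between p-adic and integer congruences, so that the power sums and binomial
  coefficients can be treated over the integers. Left to right, the denominator \<open>e\<close> of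
  the quotient is prime to \<open>p\<close> and can be cancelled.\<close>

lemma padic_cong_of_int_iff:
  assumes p: "prime p"
  shows "padic_cong p 1 (of_int a) (of_int b) \<longleftrightarrow> [a = b] (mod int p)"
proof
  have p0: "p > 0"
    using p by (rule prime_gt_0_nat)
  {
    assume "padic_cong p 1 (of_int a) (of_int b)"
    then obtain c e where e: "\<not> int p dvd e" "e \<noteq> 0"
      and ce: "(of_int a - of_int b) / of_nat p = (of_int c / of_int e :: rat)"
      unfolding padic_cong_def using padic_integerE[OF p] by (metis power_one_right)
    from ce have "(of_int ((a - b) * e) :: rat) = of_int (int p * c)"
      using e p0 by (simp add: field_simps)
    then have "(a - b) * e = int p * c"
      by (simp only: of_int_eq_iff)
    then have "int p dvd (a - b) * e"
      by simp
    then show "[a = b] (mod int p)"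
      using p e(1) by (simp add: prime_dvd_mult_iff cong_iff_dvd_diff)
  next
    assume "[a = b] (mod int p)"
    then obtain c where "a - b = int p * c"
      by (auto simp: cong_iff_dvd_diff)
    then have "(of_int a - of_int b :: rat) = of_nat p * of_int c"
      by (metis of_int_diff of_int_mult of_int_of_nat_eq)
    then show "padic_cong p 1 (of_int a) (of_int b)"
      unfolding padic_cong_def using p p0 by simp
  }
qed

section \<open>Residues and the Legendre symbol\<close>

lemma padic_cong_residue:
  assumes "prime p" "padic_integer p x"
  shows "padic_cong p 1 x (of_int (padic_residue p x))"
  using theI'[OF padic_residue_unique[OF assms]] unfolding padic_residue_def by blast

text \<open>Euler's criterion, for an arbitrary integer representative \<open>r\<close> of
  \<open>x\<close> instead of the canonical residue.\<close>

lemma padic_Legendre_cong: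
  assumes p: "prime p" "odd p" and x: "padic_integer p x" and xr: "padic_cong p 1 x (of_int r)"
  shows "[padic_Legendre x p = r ^ ((p - 1) div 2)] (mod int p)"
proof -
  have "p > 2"
    using p prime_ge_2_nat[of p] by (cases "p = 2") auto
  then have "[padic_Legendre x p = padic_residue p x ^ ((p - 1) div 2)] (mod int p)"
    unfolding padic_Legendre_def using euler_criterion[of p "padic_residue p x"] p by simp
  moreover have "[padic_residue p x = r] (mod int p)"
    using padic_cong_residue[OF p(1) x] xr p(1) padic_cong_sym padic_cong_trans
      padic_cong_of_int_iff by metis
  ultimately show ?thesis
    by (meson cong_pow cong_trans)
qed

section \<open>Power sums and binomial coefficients modulo \<open>p\<close>\<close>

text \<open>Telescoping \<open>(x + 1)\<^bsup>j+1\<^esup> - x\<^bsup>j+1\<^esup>\<close> expresses \<open>j + 1\<close> times the \<open>j\<close>-th power sum through the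
  lower ones, and \<open>j + 1\<close> is invertible.\<close>

lemma power_sum_cong_0:
  assumes p: "prime p" and "j < p - 1"
  shows "[(\<Sum>x<p. int x ^ j) = 0] (mod int p)"
  using assms(2)
proof (induction j rule: less_induct)
  case (less j)
  define S where "S i = (\<Sum>x<p. int x ^ i)" for i
  have step: "(int x + 1) ^ Suc j - int x ^ Suc j
      = (\<Sum>i<j. int (Suc j choose i) * int x ^ i) + int (Suc j) * int x ^ j" for x
    by (simp only: binomial_ring) (simp add: lessThan_Suc_atMost[symmetric] del: binomial_Suc_Suc)
  have "int p ^ Suc j = (\<Sum>x<p. (int (Suc x)) ^ Suc j - int x ^ Suc j)"
    by (subst sum_lessThan_telescope) simp
  also have "\<dots> = (\<Sum>x<p. (\<Sum>i<j. int (Suc j choose i) * int x ^ i) + int (Suc j) * int x ^ j)"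
    using step by (intro sum.cong) (simp_all add: add.commute)
  also have "\<dots> = (\<Sum>i<j. int (Suc j choose i) * S i) + int (Suc j) * S j"
    unfolding S_def sum.distrib sum_distrib_left by (subst sum.swap) simp
  finally have eq: "int p ^ Suc j = (\<Sum>i<j. int (Suc j choose i) * S i) + int (Suc j) * S j" .
  have "int p dvd S i" if "i < j" for i
    using less that unfolding S_def by (simp add: cong_0_iff)
  then have "int p dvd (\<Sum>i<j. int (Suc j choose i) * S i)"
    by (intro dvd_sum) simp
  moreover have "int p dvd int p ^ Suc j"
    by simp
  ultimately have "int p dvd int (Suc j) * S j"
    unfolding eq by (metis dvd_add_right_iff)
  moreover have "\<not> int p dvd int (Suc j)"
    using less.prems
    by (metis int_dvd_int_iff nat_dvd_not_less less_diff_conv Suc_eq_plus1 zero_less_Suc)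
  ultimately show ?case
    using p by (simp add: prime_dvd_mult_iff cong_0_iff S_def)
qed

text \<open>Fermat's little theorem reduces the exponent modulo \<open>p - 1\<close>. The case
  \<open>j = 0\<close> is excluded because \<open>0 ^ 0 = 1\<close> makes that sum \<open>p\<close>,
  hence 0 and not -1 modulo \<open>p\<close>.\<close>

lemma power_sum_cong:
  assumes p: "prime p" and j: "0 < j"
  shows "[(\<Sum>x<p. int x ^ j) = (if (p - 1) dvd j then -1 else 0)] (mod int p)"
proof -
  define q where "q = j mod (p - 1)"
  have p2: "p \<ge> 2"
    using p by (rule prime_ge_2_nat)
  have fermat: "[int x ^ (p - 1) = 1] (mod int p)" if "0 < x" "x < p" for x
  proof -
    have "[x ^ (p - 1) = 1] (mod p)"
      using p that by (intro fermat_theorem) (auto dest: dvd_imp_le)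
    then show ?thesis
      by (metis cong_int_iff of_nat_1 of_nat_power)
  qed
  have red: "[int x ^ j = int x ^ q] (mod int p)" if "0 < x" "x < p" for x
  proof -
    have "int x ^ j = (int x ^ (p - 1)) ^ (j div (p - 1)) * int x ^ q"
      unfolding q_def by (metis mult_div_mod_eq power_add power_mult)
    moreover have "[\<dots> = 1 ^ (j div (p - 1)) * int x ^ q] (mod int p)"
      using fermat[OF that] by (intro cong_mult cong_pow) auto
    ultimately show ?thesis
      by simp
  qed
  \<comment> \<open>The point 0 is split off because \<open>0 ^ j = 0\<close>, whereas
    \<open>0 ^ q = 1\<close> if \<open>q = 0\<close>.\<close>
  have split: "{..<p} = insert 0 {1..<p}"
    using p2 by auto
  have S: "[(\<Sum>x<p. int x ^ j) = (\<Sum>x=1..<p. int x ^ q)] (mod int p)"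
    proof -
    have "[(\<Sum>x=1..<p. int x ^ j) = (\<Sum>x=1..<p. int x ^ q)] (mod int p)"
      using red by (intro cong_sum) auto
    then show ?thesis
      unfolding split using j by (simp add: zero_power)
  qed
  show ?thesis
  proof (cases "(p - 1) dvd j")
    case True
    then have "(\<Sum>x=1..<p. int x ^ q) = int p - 1"
      using p2 by (simp add: q_def of_nat_diff)
    also have "[\<dots> = -1] (mod int p)"
      by (simp add: cong_iff_dvd_diff)
    finally have "[(\<Sum>x=1..<p. int x ^ q) = -1] (mod int p)" .
    with S show ?thesis
      using True cong_trans by (metis (full_types))
  next
    case False
    then have "q > 0" "q < p - 1"
      using p2 by (auto simp: q_def mod_greater_zero_iff_not_dvd)
    \<comment> \<open>As \<open>q > 0\<close>, the point 0 can be put back at no cost.\<close>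
    then have "[(\<Sum>x=1..<p. int x ^ q) = 0] (mod int p)"
      using power_sum_cong_0[OF p, of q] by (simp add: split zero_power)
    then show ?thesis
      using S False by (auto intro: cong_trans)
  qed
qed

text \<open>Both sides satisfy the same first-order recurrence modulo \<open>p\<close>, because
  \<open>2 (2k + 1) + 4 (n - k) = 2p\<close>.\<close>

lemma central_binomial_cong:
  assumes p: "prime p" and n: "p = 2 * n + 1" and "k < p"
  shows "[int ((2 * k) choose k) = (-4) ^ k * int (n choose k)] (mod int p)"
  using assms(3)
proof (induction k)
  case 0
  show ?case by simp
next
  case (Suc k)
  have central: "int (Suc k) * int ((2 * Suc k) choose Suc k)
      = 2 * (2 * int k + 1) * int ((2 * k) choose k)"
  proof -
    have "Suc k * ((2 * Suc k) choose Suc k) = 2 * (2 * k + 1) * ((2 * k) choose k)"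
    proof -
      have 1: "Suc k * (Suc (Suc (2 * k)) choose Suc k) = Suc (Suc (2 * k)) * (Suc (2 * k) choose k)"
        by (rule Suc_times_binomial)
      have 2: "Suc k * (Suc (2 * k) choose Suc k) = Suc (2 * k) * ((2 * k) choose k)"
        by (rule Suc_times_binomial)
      have "Suc (2 * k) choose k = Suc (2 * k) choose Suc k"
        using binomial_symmetric[of k "Suc (2 * k)"] by (simp add: Suc_diff_le)
      with 1 2 show ?thesis
        by (simp add: algebra_simps)
    qed
    then have "int (Suc k * ((2 * Suc k) choose Suc k)) = int (2 * (2 * k + 1) * ((2 * k) choose k))"
      by (simp only:)
    then show ?thesis
      by (simp add: algebra_simps)
  qed
  \<comment> \<open>The difference is taken over the integers because \<open>k\<close> may exceed
    \<open>n\<close>; both binomial coefficients are then 0.\<close>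
  have row: "int (Suc k) * int (n choose Suc k) = (int n - int k) * int (n choose k)"
  proof (cases "k \<le> n")
    case True
    have "Suc k * (n choose Suc k) = (n - k) * (n choose k)"
      by (simp only: binomial_absorb_comp binomial_absorption)
    then show ?thesis
      using True by (metis of_nat_diff of_nat_mult)
  next
    case False
    then show ?thesis by (simp add: binomial_eq_0)
  qed
  have "[2 * (2 * int k + 1) = (-4) * (int n - int k)] (mod int p)"
  proof -
    have "2 * (2 * int k + 1) - (-4) * (int n - int k) = int p * 2"
      using n by (simp add: algebra_simps)
    then show ?thesis
      by (simp only: cong_iff_dvd_diff dvd_triv_left)
  qed
  then have "[2 * (2 * int k + 1) * int ((2 * k) choose k)
      = (-4) * (int n - int k) * ((-4) ^ k * int (n choose k))] (mod int p)"
    using Suc.IH Suc.prems by (intro cong_mult[of _ _ _ "int ((2 * k) choose k)"]) auto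
  also have "(-4) * (int n - int k) * ((-4) ^ k * int (n choose k))
      = int (Suc k) * ((-4) ^ Suc k * int (n choose Suc k))"
  proof -
    have "(-4) * (int n - int k) * ((-4) ^ k * int (n choose k))
        = (-4) ^ Suc k * ((int n - int k) * int (n choose k))"
      by (simp only: power_Suc mult_ac)
    then show ?thesis
      unfolding row[symmetric] by (simp only: mult_ac)
  qed
  finally have "[int (Suc k) * int ((2 * Suc k) choose Suc k)
      = int (Suc k) * ((-4) ^ Suc k * int (n choose Suc k))] (mod int p)"
    unfolding central .
  moreover have "coprime (int (Suc k)) (int p)"
  proof -
    have "\<not> p dvd Suc k"
      using Suc.prems by (auto dest: dvd_imp_le)
    then show ?thesis
      using p by (metis coprime_commute coprime_int_iff prime_imp_coprime)
  qed
  ultimately show ?case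
    by (simp only: cong_mult_lcancel)
qed

section \<open>The character sum\<close>

text \<open>The factor \<open>(-1) ^ (n + 1)\<close> collects the -1 of the power sum and the sign
  \<open>(-1) ^ (n - k) * (-1) ^ k\<close> from the two expansions. Terms with
  \<open>k + d > n\<close> vanish, so \<open>k\<close> may run up to \<open>n\<close>.\<close>

lemma polynomial_sum_cong:
  fixes r :: int
  assumes p: "prime p" and n: "p = 2 * n + 1" and d: "d \<le> n"
  shows "[(\<Sum>x<p. int x ^ d * (int x * (int x - 1) * (int x - r)) ^ n)
    = (-1) ^ (n + 1) * (\<Sum>k\<le>n. int (n choose k) * int (n choose (k + d)) * (-1) ^ d * r ^ (k + d))
      - (if d = n then 1 else 0)] (mod int p)"
proof -
  \<comment> \<open>\<open>c i\<close> is the coefficient of \<open>x ^ i\<close> in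
    \<open>(x - 1) ^ n\<close>, and \<open>e j\<close> that of \<open>x ^ (n - j)\<close> in
    \<open>(x - r) ^ n\<close>.\<close>
  define c where "c i = int (n choose i) * (-1) ^ (n - i)" for i
  define e where "e j = int (n choose j) * (-r) ^ j" for j
  \<comment> \<open>\<open>w i j\<close> is the power sum of exponent
    \<open>2 * n + d + i - j\<close> modulo \<open>p\<close>: the first indicator detects the
    exponent \<open>2 * n\<close>, the second \<open>4 * n\<close>, which forces
    \<open>i = d = n\<close> and \<open>j = 0\<close>.\<close>
  define w :: "nat \<Rightarrow> nat \<Rightarrow> int" where
    "w i j = - (if j = i + d then 1 else 0) - (if j = 0 then if i = n \<and> d = n then 1 else 0 else 0)" for i j
  have n0: "n > 0"
    using prime_ge_2_nat[OF p] n by auto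
  have "int x ^ d * (int x * (int x - 1) * (int x - r)) ^ n
      = (\<Sum>i\<le>n. \<Sum>j\<le>n. c i * e j * int x ^ (2 * n + d + i - j))" for x
  proof -
    have 1: "(int x - 1) ^ n = (\<Sum>i\<le>n. c i * int x ^ i)"
      using binomial_ring[of "int x" "-1" n] by (simp add: c_def mult_ac)
    have 2: "(int x - r) ^ n = (\<Sum>j\<le>n. e j * int x ^ (n - j))"
      using binomial_ring[of "-r" "int x" n] by (simp add: e_def mult_ac)
    have "int x ^ d * (int x * (int x - 1) * (int x - r)) ^ n
        = int x ^ (n + d) * ((\<Sum>i\<le>n. c i * int x ^ i) * (\<Sum>j\<le>n. e j * int x ^ (n - j)))"
      by (simp add: power_mult_distrib power_add 1 2)
    also have "\<dots> = (\<Sum>i\<le>n. \<Sum>j\<le>n. int x ^ (n + d) * (c i * int x ^ i * (e j * int x ^ (n - j))))"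
      by (subst sum_product) (simp only: sum_distrib_left)
    also have "\<dots> = (\<Sum>i\<le>n. \<Sum>j\<le>n. c i * e j * int x ^ (2 * n + d + i - j))"
    proof (intro sum.cong refl)
      fix i j assume "j \<in> {..n}"
      then have "2 * n + d + i - j = n + d + i + (n - j)"
        by simp
      then have "int x ^ (2 * n + d + i - j) = int x ^ (n + d) * int x ^ i * int x ^ (n - j)"
        by (simp only: power_add)
      then show "int x ^ (n + d) * (c i * int x ^ i * (e j * int x ^ (n - j)))
          = c i * e j * int x ^ (2 * n + d + i - j)"
        by simp
    qed
    finally show ?thesis .
  qed
  then have "(\<Sum>x<p. int x ^ d * (int x * (int x - 1) * (int x - r)) ^ n)
      = (\<Sum>x<p. \<Sum>i\<le>n. \<Sum>j\<le>n. c i * e j * int x ^ (2 * n + d + i - j))"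
    by simp
  also have "\<dots> = (\<Sum>i\<le>n. \<Sum>x<p. \<Sum>j\<le>n. c i * e j * int x ^ (2 * n + d + i - j))"
    by (rule sum.swap)
  also have "\<dots> = (\<Sum>i\<le>n. \<Sum>j\<le>n. c i * e j * (\<Sum>x<p. int x ^ (2 * n + d + i - j)))"
    unfolding sum_distrib_left by (intro sum.cong refl sum.swap)
  finally have expand: "(\<Sum>x<p. int x ^ d * (int x * (int x - 1) * (int x - r)) ^ n)
      = (\<Sum>i\<le>n. \<Sum>j\<le>n. c i * e j * (\<Sum>x<p. int x ^ (2 * n + d + i - j)))" .
  have reduce: "[(\<Sum>i\<le>n. \<Sum>j\<le>n. c i * e j * (\<Sum>x<p. int x ^ (2 * n + d + i - j)))
      = (\<Sum>i\<le>n. \<Sum>j\<le>n. c i * e j * w i j)] (mod int p)"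
  proof (intro cong_sum cong_mult cong_refl)
    fix i j assume ij: "i \<in> {..n}" "j \<in> {..n}"
    define m where "m = 2 * n + d + i - j"
    \<comment> \<open>Positivity is what \<open>power_sum_cong\<close> requires, and the upper bound
      leaves only two multiples of \<open>p - 1 = 2 * n\<close>.\<close>
    have m: "m > 0" "m \<le> 4 * n" "m + j = 2 * n + d + i"
      using ij d n0 by (auto simp: m_def)
    have "(p - 1) dvd m \<longleftrightarrow> m = 2 * n \<or> m = 4 * n"
    proof
      assume "(p - 1) dvd m"
      then obtain t where t: "m = 2 * n * t"
        using n by auto
      then have "t > 0" "t \<le> 2"
        using m n0 by (auto intro!: Nat.gr0I)
      then have "t = 1 \<or> t = 2"
        by auto
      then show "m = 2 * n \<or> m = 4 * n"
        using t by auto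
    qed (use n in auto)
    also have "\<dots> \<longleftrightarrow> j = i + d \<or> (j = 0 \<and> i = n \<and> d = n)"
      using m(3) ij d by auto
    finally have "(if (p - 1) dvd m then -1 else 0 :: int) = w i j"
      using n0 by (auto simp: w_def)
    with power_sum_cong[OF p m(1)]
    show "[(\<Sum>x<p. int x ^ (2 * n + d + i - j)) = w i j] (mod int p)"
      by (simp only: m_def)
  qed
  have "(\<Sum>i\<le>n. \<Sum>j\<le>n. c i * e j * w i j)
    = (\<Sum>i\<le>n. - (c i * e (i + d)) - (if i = n then if d = n then 1 else 0 else 0))"
  proof (intro sum.cong refl)
    fix i assume "i \<in> {..n}"
    have "(\<Sum>j\<le>n. c i * e j * w i j)
      = (\<Sum>j\<le>n. (if j = i + d then - (c i * e j) else 0)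
          - (if j = 0 then c i * e j * (if i = n \<and> d = n then 1 else 0) else 0))"
      by (intro sum.cong refl) (auto simp: w_def)
    \<comment> \<open>If \<open>i + d > n\<close>, no \<open>j\<close> matches, in agreement with
      \<open>e (i + d) = 0\<close>. The delta term has weight \<open>c n * e 0 = 1\<close>.\<close>
    also have "\<dots> = - (c i * e (i + d)) - (if i = n then if d = n then 1 else 0 else 0)"
      unfolding sum_subtractf by (auto simp: sum.delta e_def c_def)
    finally show "(\<Sum>j\<le>n. c i * e j * w i j)
      = - (c i * e (i + d)) - (if i = n then if d = n then 1 else 0 else 0)" .
  qed
  also have "\<dots> = (\<Sum>i\<le>n. - (c i * e (i + d))) - (if d = n then 1 else 0)"
    unfolding sum_subtractf by (simp add: sum.delta)
  also have "(\<Sum>i\<le>n. - (c i * e (i + d))) = (-1) ^ (n + 1) *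
      (\<Sum>k\<le>n. int (n choose k) * int (n choose (k + d)) * (-1) ^ d * r ^ (k + d))"
    unfolding sum_distrib_left
  proof (intro sum.cong refl)
    fix k assume "k \<in> {..n}"
    then have "(-1 :: int) ^ (n - k) * (-1) ^ k = (-1) ^ n"
      by (simp flip: power_add)
    moreover have "(- r) ^ (k + d) = (-1) ^ k * (-1) ^ d * r ^ (k + d)"
      by (simp add: power_minus[of r] power_add)
    ultimately show "- (c k * e (k + d))
        = (-1) ^ (n + 1) * (int (n choose k) * int (n choose (k + d)) * (-1) ^ d * r ^ (k + d))"
      by (simp add: c_def e_def mult_ac)
  qed
  finally show ?thesis
    using reduce unfolding expand by simp
qed

theorem theorem1p1:
  fixes p d :: nat and l :: rat
  assumes "prime p" and "odd p"
    and "d \<le> (p - 1) div 2"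
    and "padic_integer p l"
  shows "padic_cong p 1
    (of_int (a_sum p d l))
    ((-1) ^ ((p + 1) div 2) * (l ^ d / 4 ^ d) *
       (\<Sum>k = 0..(p - 1) div 2.
          of_nat ((2 * k) choose k) * of_nat ((2 * (k + d)) choose (k + d)) / 16 ^ k * l ^ k)
     - (if d = (p - 1) div 2 then 1 else 0))"
proof -
  note p = assms(1)
  define n where "n = (p - 1) div 2"
  have n: "p = 2 * n + 1" and n1: "(p + 1) div 2 = n + 1" and d: "d \<le> n"
    using assms(2,3) by (auto simp: n_def elim!: oddE)
  define r where "r = padic_residue p l"
  have lr: "padic_cong p 1 l (of_int r)"
    unfolding r_def using assms by (intro padic_cong_residue)
  \<comment> \<open>\<open>B k\<close> is the p-integral stand-in for \<open>n choose k\<close>; as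
    \<open>p\<close> is odd, powers of -4 are invertible modulo \<open>p\<close>.\<close>
  define B where "B k = of_nat ((2 * k) choose k) / (-4 :: rat) ^ k" for k
  have not_dvd: "\<not> int p dvd (-4) ^ k" for k
  proof
    assume "int p dvd (-4) ^ k"
    then have "int p dvd - (2 ^ 2)"
      using p prime_dvd_power[of "int p" "-4" k] by simp
    then have "int p dvd 2"
      using p prime_dvd_power[of "int p" 2 2] by (simp only: dvd_minus_iff) simp
    then have "p dvd 2"
      by presburger
    then show False
      using p assms(2) by (metis primes_dvd_imp_eq two_is_prime_nat)
  qed
  have B_int: "padic_integer p (B k)" for k
    using padic_integer_divide[OF p not_dvd, of "int ((2 * k) choose k)" k] by (simp add: B_def)
  have B_cong: "padic_cong p 1 (of_int (int (n choose k))) (B k)" if "k < p" for k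
  proof -
    have "padic_cong p 1 (of_int ((-4) ^ k * int (n choose k))) (of_int (int ((2 * k) choose k)))"
      using central_binomial_cong[OF p n that] p by (simp only: padic_cong_of_int_iff cong_sym)
    from padic_cong_mult_left[OF p this, of "1 / (-4) ^ k"] show ?thesis
      using padic_integer_divide[OF p not_dvd, of 1 k] by (simp add: B_def)
  qed
  have euler: "padic_cong p 1 (of_int (a_sum p d l))
      (of_int (\<Sum>x<p. int x ^ d * (int x * (int x - 1) * (int x - r)) ^ n))"
  proof -
    have "[padic_Legendre (of_nat x * (of_nat x - 1) * (of_nat x - l)) p
        = (int x * (int x - 1) * (int x - r)) ^ n] (mod int p)" for x
    proof -
      have xi: "padic_integer p (of_nat x * (of_nat x - 1))"
        using padic_integer_of_int[OF p, of "int x * (int x - 1)"] by simp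
      have "padic_integer p (of_nat x - l)"
        using padic_integer_add[OF p padic_integer_of_int[OF p, of "int x"]
            padic_integer_minus[OF p assms(4)]] by simp
      moreover have "padic_cong p 1 (of_nat x * (of_nat x - 1) * (of_nat x - l))
          (of_nat x * (of_nat x - 1) * (of_nat x - of_int r))"
        using p lr xi by (intro padic_cong_mult_left padic_cong_diff padic_cong_refl)
      ultimately show ?thesis
        unfolding n_def using xi assms(1,2)
        by (intro padic_Legendre_cong padic_integer_mult[OF p xi]) simp_all
    qed
    then have "[a_sum p d l = (\<Sum>x = 0..p - 1. int x ^ d * (int x * (int x - 1) * (int x - r)) ^ n)]
        (mod int p)"
      unfolding a_sum_def by (intro cong_sum cong_mult cong_refl)
    moreover have "{0..p - 1} = {..<p}"
      using n by auto
    ultimately show ?thesis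
      using p by (simp only: padic_cong_of_int_iff)
  qed
  have expand: "padic_cong p 1
    (of_int (\<Sum>x<p. int x ^ d * (int x * (int x - 1) * (int x - r)) ^ n))
    (of_int ((-1) ^ (n + 1) *
        (\<Sum>k\<le>n. int (n choose k) * int (n choose (k + d)) * (-1) ^ d * r ^ (k + d))
      - (if d = n then 1 else 0)))"
    using polynomial_sum_cong[OF p n d] p by (simp only: padic_cong_of_int_iff)
  have binom: "padic_cong p 1
    (of_int ((-1) ^ (n + 1) *
        (\<Sum>k\<le>n. int (n choose k) * int (n choose (k + d)) * (-1) ^ d * r ^ (k + d))
      - (if d = n then 1 else 0)))
    ((-1) ^ (n + 1) *
        (\<Sum>k\<le>n. B k * B (k + d) * (-1) ^ d * l ^ (k + d)) - (if d = n then 1 else 0))"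
  proof -
    have summand: "padic_cong p 1
        (of_int (int (n choose k)) * of_int (int (n choose (k + d))) * (-1) ^ d * of_int r ^ (k + d))
        (B k * B (k + d) * (-1) ^ d * l ^ (k + d))" if "k \<le> n" for k
    proof -
      have minus_one: "padic_integer p (-1)"
        using padic_integer_of_int[OF p, of "-1"] by simp
      \<comment> \<open>Here \<open>k + d \<le> 2 * n = p - 1\<close>, so \<open>B_cong\<close>
        covers both binomial coefficients.\<close>
      have "k < p" "k + d < p"
        using that d n by auto
      moreover have "padic_cong p 1 (of_int r ^ (k + d)) (l ^ (k + d))"
        by (rule padic_cong_sym[OF p padic_cong_power[OF p lr assms(4)]])
      ultimately show ?thesis
        using p B_int minus_one assms(4)
        by (intro padic_cong_mult B_cong padic_cong_refl padic_integer_mult padic_integer_power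
            padic_integer_of_int)
    qed
    have "padic_integer p ((-1) ^ (n + 1))"
      using padic_integer_of_int[OF p, of "(-1) ^ (n + 1)"] by simp
    then have "padic_cong p 1
        ((-1) ^ (n + 1) * (\<Sum>k\<le>n. of_int (int (n choose k)) * of_int (int (n choose (k + d)))
            * (-1) ^ d * of_int r ^ (k + d)) - (if d = n then 1 else 0))
        ((-1) ^ (n + 1) * (\<Sum>k\<le>n. B k * B (k + d) * (-1) ^ d * l ^ (k + d))
          - (if d = n then 1 else 0))"
      using p summand by (intro padic_cong_diff padic_cong_mult_left padic_cong_sum padic_cong_refl) auto
    then show ?thesis
      by (cases "d = n") simp_all
  qed
  \<comment> \<open>An exact identity over the rationals: the two denominators multiply to
    \<open>16 ^ k * (-4) ^ d\<close>, whose sign cancels the factor \<open>(-1) ^ d\<close>.\<close>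
  have "(-1) ^ (n + 1) * (\<Sum>k\<le>n. B k * B (k + d) * (-1) ^ d * l ^ (k + d))
    = (-1) ^ (n + 1) * (l ^ d / 4 ^ d) * (\<Sum>k = 0..n.
          of_nat ((2 * k) choose k) * of_nat ((2 * (k + d)) choose (k + d)) / 16 ^ k * l ^ k)"
  proof -
    have "B k * B (k + d) * (-1) ^ d * l ^ (k + d) = l ^ d / 4 ^ d *
        (of_nat ((2 * k) choose k) * of_nat ((2 * (k + d)) choose (k + d)) / 16 ^ k * l ^ k)" for k
    proof -
      have "(-4 :: rat) ^ k * (-4) ^ (k + d) = 16 ^ k * ((-1) ^ d * 4 ^ d)"
        by (simp add: power_add flip: power_mult_distrib)
      then have "B k * B (k + d) = of_nat ((2 * k) choose k) * of_nat ((2 * (k + d)) choose (k + d))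
          / (16 ^ k * ((-1) ^ d * 4 ^ d))"
        unfolding B_def by (simp only: times_divide_times_eq)
      moreover have "(-1 :: rat) ^ d * (-1) ^ d = 1"
        by (simp flip: power_mult_distrib)
      ultimately show ?thesis
        by (simp add: power_add field_simps)
    qed
    then show ?thesis
      by (simp only: sum_distrib_left atMost_atLeast0 mult.assoc)
  qed
  with padic_cong_trans[OF p padic_cong_trans[OF p euler expand] binom] show ?thesis
    unfolding n1 n_def[symmetric] by (simp only:)
qed

end
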